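(* Let $q$ and $n$ be positive integers. For every $\sigma\in S_n$, $$\ell_q(\sigma)=inv_q(\sigma).$$
   Context: Permutations $\pi\in S_n$ are written $[\pi(1),\dots,\pi(n)]$ and multiplied as functions: $(\sigma\tau)(i)=\sigma(\tau(i))$. Let $s_i=(i,i+1)$, $1\le i\le n-1$, be the Coxeter generators of $S_n$. Canonical presentation: for $1\le j\le n-1$ let $R_j=\{1,\ s_j,\ s_js_{j-1},\ \ldots,\ s_js_{j-1}\cdots s_1\}$. Every $w\in S_n$ can be written uniquely as $w=w_1w_2\cdots w_{n-1}$ with $w_j\in R_j$; this product, regarded as a word in the $s_i$ (each $w_j$ being spelled as displayed in $R_j$), is the canonical presentation of $w$. The $q$-length $\ell_q(\pi)$ is the number of letters in the canonical presentation of $\pi$ where the letters $s_1,\dots,s_{q-1}$ are not counted (i.e. the number of letters $s_i$ with $i\ge q$, counted with multiplicity). The $q$-inversion number is $inv_q(\pi)=0$ if $n\le q$, and, if $q<n$, $inv_q(\pi)=\sum_{i=q+1}^n m_q(i)$, where $m_q(i)=\min\{\,i-q,\ \#\{j<i\mid \pi(j)>\pi(i)\}\,\}$. *)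

theory Defs
  imports "HOL-Combinatorics.Permutations"
begin

text \<open>
  Elements of $S_n$ are the functions \<open>\<pi>\<close> with \<open>\<pi> permutes {1..n}\<close>; multiplication is \<open>(\<circ>)\<close>.
  A word in the Coxeter generators is the list of the indices of its letters.
\<close>

definition coxeter_gen :: "nat \<Rightarrow> nat \<Rightarrow> nat" where
  "coxeter_gen i = transpose i (i + 1)"

definition word_prod :: "nat list \<Rightarrow> nat \<Rightarrow> nat" where
  "word_prod ws = foldr (\<lambda>i \<pi>. coxeter_gen i \<circ> \<pi>) ws id"

text \<open>
  $R_j$ with its elements spelled as words $s_j s_{j-1} \cdots s_k$, that is \<open>[j, j - 1, ..., k]\<close>;
  \<open>k = j + 1\<close> gives the empty word, i.e. the identity.
\<close>

definition R_words :: "nat \<Rightarrow> nat list set" where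
  "R_words j = {rev [k..<j + 1] | k. 1 \<le> k \<and> k \<le> j + 1}"

definition is_canonical_presentation :: "nat \<Rightarrow> (nat \<Rightarrow> nat) \<Rightarrow> nat list \<Rightarrow> bool" where
  "is_canonical_presentation n \<pi> ws \<longleftrightarrow>
     (\<exists>w. (\<forall>j\<in>{1..n - 1}. w j \<in> R_words j) \<and>
          ws = concat (map w [1..<n]) \<and> word_prod ws = \<pi>)"

definition canonical_presentation :: "nat \<Rightarrow> (nat \<Rightarrow> nat) \<Rightarrow> nat list" where
  "canonical_presentation n \<pi> = (THE ws. is_canonical_presentation n \<pi> ws)"

definition q_length :: "nat \<Rightarrow> nat \<Rightarrow> (nat \<Rightarrow> nat) \<Rightarrow> nat" where
  "q_length q n \<pi> = length (filter (\<lambda>i. q \<le> i) (canonical_presentation n \<pi>))"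

definition m_q :: "nat \<Rightarrow> (nat \<Rightarrow> nat) \<Rightarrow> nat \<Rightarrow> nat" where
  "m_q q \<pi> i = min (i - q) (card {j\<in>{1..<i}. \<pi> j > \<pi> i})"

definition inv_q :: "nat \<Rightarrow> nat \<Rightarrow> (nat \<Rightarrow> nat) \<Rightarrow> nat" where
  "inv_q q n \<pi> = (if n \<le> q then 0 else \<Sum>i=q + 1..n. m_q q \<pi> i)"

end

theory Submission
  imports Defs
begin

text \<open>
  A factor $w_n = s_n s_{n-1} \cdots s_k$ (empty for \<open>k = n + 1\<close>) is the cycle that sends \<open>k\<close> to \<open>n + 1\<close> and
  shifts \<open>k + 1, \<dots>, n + 1\<close> down by one. Multiplying \<open>\<pi> \<in> S_n\<close> by it on the right therefore inserts
  the new largest value \<open>n + 1\<close> into $[\pi(1), \ldots, \pi(n)]$ at position \<open>k\<close>. Every element of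
  $S_{n+1}$ arises in this way, and \<open>k\<close> and \<open>\<pi>\<close> can be read off from it; this gives existence and
  uniqueness of the canonical presentation by induction on \<open>n\<close>.

  The same induction compares the two statistics. After the insertion the entry at \<open>k\<close> has no
  larger entry to its left, the entries before \<open>k\<close> are unaffected, and each entry behind \<open>k\<close>
  moves one position to the right and gains exactly one larger entry to its left. So for an entry
  that ends up at a position \<open>i > k\<close> both arguments of the minimum in \<open>m_q\<close> grow by one, provided that
  \<open>i > q\<close>, whereas \<open>m_q\<close> stays \<open>0\<close> if \<open>i \<le> q\<close>. Hence the sum grows by the number of positions
  in \<open>{max k q<..n + 1}\<close>, which is also the number of letters $s_i$ of $w_n$ with \<open>i \<ge> q\<close>.
\<close>

lemma word_prod_append: "word_prod (us @ vs) = word_prod us \<circ> word_prod vs"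
  by (induction us) (simp_all add: word_prod_def o_assoc)

lemma word_prod_descending:
  assumes "k \<le> m"
  shows "word_prod (rev [k..<m]) i = (if i = k then m else if k < i \<and> i \<le> m then i - 1 else i)"
  using assms
proof (induction m rule: dec_induct)
  case base
  show ?case by (simp add: word_prod_def)
next
  case (step m)
  have "word_prod (rev [k..<Suc m]) i = coxeter_gen m (word_prod (rev [k..<m]) i)"
    using step.hyps by (simp add: word_prod_def)
  then show ?case
    unfolding step.IH using step.hyps by (auto simp: coxeter_gen_def transpose_def)
qed

text \<open>
  After an insertion at position \<open>k\<close>, this is how the positions of the older entries correspond to
  their previous positions.
\<close>

lemma bij_betw_word_prod_descending:
  assumes "1 \<le> k" "k \<le> m"
  shows "bij_betw (word_prod (rev [k..<m])) ({1..m} - {k}) {1..<m}"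
  by (rule bij_betw_byWitness[where f' = "\<lambda>i. if i < k then i else i + 1"])
     (use assms in \<open>auto simp: word_prod_descending split: if_splits\<close>)

lemma word_prod_descending_permutes:
  assumes "1 \<le> k" "k \<le> m"
  shows "word_prod (rev [k..<m]) permutes {1..m}"
proof (rule bij_imp_permutes)
  have "bij_betw (word_prod (rev [k..<m])) (({1..m} - {k}) \<union> {k}) ({1..<m} \<union> {m})"
    using bij_betw_word_prod_descending[OF assms] assms
    by (intro bij_betw_combine) (auto simp: word_prod_descending)
  moreover have "({1..m} - {k}) \<union> {k} = {1..m}" "{1..<m} \<union> {m} = {1..m}"
    using assms by auto
  ultimately show "bij_betw (word_prod (rev [k..<m])) {1..m} {1..m}" by simp
qed (use assms in \<open>auto simp: word_prod_descending\<close>)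

lemma length_filter_ge_upt: "length (filter ((\<le>) q) [k..<m]) = m - max k q"
  by (induction m) auto

section \<open>Canonical presentations\<close>

lemma is_canonical_presentation_1: "is_canonical_presentation 1 \<pi> ws \<longleftrightarrow> ws = [] \<and> \<pi> = id"
  by (auto simp: is_canonical_presentation_def word_prod_def)

lemma is_canonical_presentation_Suc:
  assumes "1 \<le> n"
  shows "is_canonical_presentation (Suc n) \<pi> ws \<longleftrightarrow>
    (\<exists>k\<in>{1..Suc n}. \<exists>\<rho> us. is_canonical_presentation n \<rho> us \<and>
       ws = us @ rev [k..<Suc n] \<and> \<pi> = \<rho> \<circ> word_prod (rev [k..<Suc n]))"
    (is "?L \<longleftrightarrow> ?R")
proof
  assume ?L
  then obtain w where w: "\<forall>j\<in>{1..n}. w j \<in> R_words j"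
    and ws: "ws = concat (map w [1..<Suc n])" "word_prod ws = \<pi>"
    by (auto simp: is_canonical_presentation_def)
  obtain k where k: "k \<in> {1..Suc n}" "w n = rev [k..<Suc n]"
    using w assms by (force simp: R_words_def)
  let ?us = "concat (map w [1..<n])"
  have "is_canonical_presentation n (word_prod ?us) ?us"
    unfolding is_canonical_presentation_def using w by (intro exI[of _ w]) auto
  moreover have split: "ws = ?us @ rev [k..<Suc n]"
    using ws(1) k(2) assms by simp
  moreover have "\<pi> = word_prod ?us \<circ> word_prod (rev [k..<Suc n])"
    using ws(2) split by (simp only: word_prod_append)
  ultimately show ?R using k(1) by blast
next
  assume ?R
  then obtain k \<rho> us where k: "k \<in> {1..Suc n}" and us: "is_canonical_presentation n \<rho> us"
    and ws: "ws = us @ rev [k..<Suc n]" and \<pi>: "\<pi> = \<rho> \<circ> word_prod (rev [k..<Suc n])"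
    by blast
  obtain w where w: "\<forall>j\<in>{1..n - 1}. w j \<in> R_words j"
    "us = concat (map w [1..<n])" "word_prod us = \<rho>"
    using us by (auto simp: is_canonical_presentation_def)
  let ?w = "w(n := rev [k..<Suc n])"
  have "rev [k..<Suc n] \<in> R_words n"
    using k unfolding R_words_def by auto
  then have "\<forall>j\<in>{1..Suc n - 1}. ?w j \<in> R_words j"
    using w(1) by auto
  moreover have "ws = concat (map ?w [1..<Suc n])"
  proof -
    have "map ?w [1..<n] = map w [1..<n]" by simp
    then show ?thesis using assms ws w(2) by (simp del: upt_Suc add: upt_Suc_append)
  qed
  moreover have "word_prod ws = \<pi>"
    using ws \<pi> w(3) by (simp only: word_prod_append)
  ultimately show ?L unfolding is_canonical_presentation_def by blast
qed

lemma is_canonical_presentation_permutes: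
  assumes "1 \<le> n" "is_canonical_presentation n \<pi> ws"
  shows "\<pi> permutes {1..n}"
  using assms
proof (induction n arbitrary: \<pi> ws rule: dec_induct)
  case base
  then show ?case by (simp add: is_canonical_presentation_1[unfolded One_nat_def] id_def)
next
  case (step n)
  obtain k \<rho> us where k: "k \<in> {1..Suc n}" and us: "is_canonical_presentation n \<rho> us"
    and \<pi>: "\<pi> = \<rho> \<circ> word_prod (rev [k..<Suc n])"
    using step.prems is_canonical_presentation_Suc[OF step.hyps(1)] by blast
  have "\<rho> permutes {1..Suc n}"
    by (rule permutes_subset[OF step.IH[OF us]]) auto
  then show ?case
    unfolding \<pi> using k by (intro permutes_compose word_prod_descending_permutes) auto
qed

lemma permutes_fixes_Suc: "\<rho> permutes {1..n} \<Longrightarrow> \<rho> (Suc n) = Suc n"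
  by (rule permutes_not_in) auto

text \<open>
  The position of the value \<open>n + 1\<close> determines the last factor, because the product of the
  remaining factors fixes \<open>n + 1\<close>; cancelling the last factor reduces \<open>n\<close>.
\<close>

lemma is_canonical_presentation_unique:
  assumes "1 \<le> n" "is_canonical_presentation n \<pi> ws" "is_canonical_presentation n \<pi> ws'"
  shows "ws = ws'"
  using assms
proof (induction n arbitrary: \<pi> ws ws' rule: dec_induct)
  case base
  then show ?case by (simp add: is_canonical_presentation_1[unfolded One_nat_def])
next
  case (step n)
  have decompose: "\<exists>k \<rho> us. k \<in> {1..Suc n} \<and> is_canonical_presentation n \<rho> us \<and>
      vs = us @ rev [k..<Suc n] \<and> \<pi> = \<rho> \<circ> word_prod (rev [k..<Suc n]) \<and> \<pi> k = Suc n"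
    if vs: "is_canonical_presentation (Suc n) \<pi> vs" for vs
  proof -
    obtain k \<rho> us where k: "k \<in> {1..Suc n}" and us: "is_canonical_presentation n \<rho> us"
      and eq: "vs = us @ rev [k..<Suc n]" "\<pi> = \<rho> \<circ> word_prod (rev [k..<Suc n])"
      using vs is_canonical_presentation_Suc[OF step.hyps(1)] by blast
    have "\<pi> k = Suc n"
      using k permutes_fixes_Suc[OF is_canonical_presentation_permutes[OF step.hyps(1) us]]
      unfolding eq(2) o_apply by (subst word_prod_descending) auto
    with k us eq show ?thesis by blast
  qed
  obtain k \<rho> us where k: "k \<in> {1..Suc n}" "\<pi> k = Suc n"
    and us: "is_canonical_presentation n \<rho> us"
    and ws: "ws = us @ rev [k..<Suc n]" and \<rho>: "\<pi> = \<rho> \<circ> word_prod (rev [k..<Suc n])"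
    using decompose[OF step.prems(1)] by blast
  obtain k' \<rho>' us' where k': "\<pi> k' = Suc n"
    and us': "is_canonical_presentation n \<rho>' us'"
    and ws': "ws' = us' @ rev [k'..<Suc n]" and \<rho>': "\<pi> = \<rho>' \<circ> word_prod (rev [k'..<Suc n])"
    using decompose[OF step.prems(2)] by blast
  have "inj \<pi>"
    using permutes_inj[OF is_canonical_presentation_permutes[OF _ step.prems(1)]] by simp
  then have "k' = k" using k(2) k' by (metis injD)
  have "surj (word_prod (rev [k..<Suc n]))"
    using k by (intro permutes_surj[OF word_prod_descending_permutes]) auto
  moreover have "\<rho> \<circ> word_prod (rev [k..<Suc n]) = \<rho>' \<circ> word_prod (rev [k..<Suc n])"
    using \<rho> \<rho>' \<open>k' = k\<close> by simp
  ultimately have "\<rho> = \<rho>'"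
    by (metis surj_fun_eq fun.map_comp)
  then have "us = us'" using step.IH us us' by blast
  then show ?case using ws ws' \<open>k' = k\<close> by simp
qed

text \<open>
  Undoing the insertion: for \<open>k\<close> the position of the value \<open>n + 1\<close> in \<open>\<pi>\<close>, dividing \<open>\<pi>\<close> on
  the right by the cycle $s_n \cdots s_k$ moves that value back to position \<open>n + 1\<close> and so leaves an
  element of $S_n$.
\<close>

lemma is_canonical_presentation_exists:
  assumes "1 \<le> n" "\<pi> permutes {1..n}"
  shows "\<exists>ws. is_canonical_presentation n \<pi> ws"
  using assms
proof (induction n arbitrary: \<pi> rule: dec_induct)
  case base
  then show ?case by (simp add: is_canonical_presentation_1[unfolded One_nat_def] id_def)
next
  case (step n)
  have "Suc n \<in> \<pi> ` {1..Suc n}" using permutes_image[OF step.prems] by simp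
  then obtain k where k: "k \<in> {1..Suc n}" "\<pi> k = Suc n" by (metis imageE)
  define c where "c = word_prod (rev [k..<Suc n])"
  have c: "c permutes {1..Suc n}"
    unfolding c_def using k(1) by (intro word_prod_descending_permutes) auto
  have "c k = Suc n"
    unfolding c_def using k(1) by (subst word_prod_descending) auto
  then have "inv c (Suc n) = k"
    using permutes_inverses(2)[OF c] by metis
  then have "(\<pi> \<circ> inv c) (Suc n) = Suc n"
    using k(2) by simp
  moreover have "\<pi> \<circ> inv c permutes {1..Suc n}"
    by (intro permutes_compose permutes_inv c step.prems)
  ultimately have "\<pi> \<circ> inv c permutes {1..n}"
    by (elim permutes_superset) (auto simp: le_Suc_eq)
  then obtain us where us: "is_canonical_presentation n (\<pi> \<circ> inv c) us"
    using step.IH by blast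
  have "\<pi> = (\<pi> \<circ> inv c) \<circ> c"
    using permutes_inv_o(2)[OF c] by (simp add: o_assoc[symmetric])
  then show ?case
    using k(1) us is_canonical_presentation_Suc[OF step.hyps(1)] unfolding c_def by blast
qed

section \<open>Inserting a new maximum\<close>

text \<open>
  Truncated subtraction gives \<open>m_q q \<pi> i = 0\<close> for \<open>i \<le> q\<close>. Summing over all positions removes
  the case distinction on \<open>n \<le> q\<close> and lets the sum be reindexed by position shifts that cross \<open>q\<close>.
\<close>

lemma inv_q_eq_sum: "inv_q q n \<pi> = (\<Sum>i = 1..n. m_q q \<pi> i)"
proof -
  have "(\<Sum>i = q + 1..n. m_q q \<pi> i) = (\<Sum>i = 1..n. m_q q \<pi> i)"
    by (rule sum.mono_neutral_left) (auto simp: m_q_def)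
  then show ?thesis unfolding inv_q_def by (cases "n \<le> q") simp_all
qed

text \<open>
  The entry at a position \<open>i \<noteq> k\<close> came from position \<open>word_prod (rev [k..<Suc n]) i\<close>. If \<open>i > k\<close>,
  both \<open>i - q\<close> and the number of larger entries to its left have grown by one, except that
  \<open>i - q\<close>, and with it the minimum, remains \<open>0\<close> when \<open>i \<le> q\<close>.
\<close>

lemma m_q_insert_max:
  assumes \<rho>: "\<rho> permutes {1..n}" and k: "k \<in> {1..Suc n}" and i: "i \<in> {1..Suc n} - {k}"
  defines "c \<equiv> word_prod (rev [k..<Suc n])"
  shows "m_q q (\<rho> \<circ> c) i = m_q q \<rho> (c i) + of_bool (max k q < i)"
proof -
  define A where "A = {j\<in>{1..<i}. \<rho> (c j) > \<rho> (c i)}"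
  define B where "B = {j\<in>{1..<c i}. \<rho> j > \<rho> (c i)}"
  have c: "c j = (if j = k then Suc n else if k < j \<and> j \<le> Suc n then j - 1 else j)" for j
    unfolding c_def using k by (intro word_prod_descending) auto
  have "inj c"
    unfolding c_def using k by (intro permutes_inj[OF word_prod_descending_permutes]) auto
  then have card_A: "card (c ` A) = card A"
    by (intro card_image) (rule inj_on_subset, auto)
  have "\<rho> (c i) \<in> {1..n}"
    using i k by (subst permutes_in_image[OF \<rho>]) (auto simp: c)
  then have max: "\<rho> (c i) < \<rho> (Suc n)"
    using permutes_fixes_Suc[OF \<rho>] by simp
  show ?thesis
  proof (cases "i < k")
    case True
    then have "A = B"
      by (auto simp: A_def B_def c)
    with True show ?thesis by (simp add: m_q_def A_def B_def c)
  next
    case False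
    then have "k < i" using i by simp
    then have "c i = i - 1" using i by (simp add: c)
    \<comment> \<open>Traced back to their old positions, the entries to the left of \<open>i\<close> are those that were
      there before, together with the new maximum.\<close>
    have "c ` {1..<i} = insert (Suc n) {1..<i - 1}"
    proof (intro set_eqI iffI)
      fix x assume "x \<in> insert (Suc n) {1..<i - 1}"
      then have "x = c (if x = Suc n then k else if x < k then x else x + 1)"
        "(if x = Suc n then k else if x < k then x else x + 1) \<in> {1..<i}"
        using \<open>k < i\<close> i k by (auto simp: c)
      then show "x \<in> c ` {1..<i}" by (rule image_eqI)
    qed (use \<open>k < i\<close> i k in \<open>auto simp: c split: if_splits\<close>)
    moreover have "c ` A = {x \<in> c ` {1..<i}. \<rho> x > \<rho> (c i)}"
      by (auto simp: A_def)
    ultimately have "c ` A = insert (Suc n) B"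
      using max \<open>c i = i - 1\<close> by (auto simp: B_def)
    moreover have "finite B" "Suc n \<notin> B"
      using i \<open>c i = i - 1\<close> by (auto simp: B_def)
    ultimately have "card A = Suc (card B)"
      using card_A by simp
    moreover have "m_q q (\<rho> \<circ> c) i = min (i - q) (card A)"
      by (simp add: m_q_def A_def)
    moreover have "m_q q \<rho> (c i) = min (i - 1 - q) (card B)"
      using \<open>c i = i - 1\<close> by (simp add: m_q_def B_def)
    ultimately show ?thesis
      using \<open>k < i\<close> by (cases "q < i") auto
  qed
qed

text \<open>
  The new maximum itself contributes nothing, as no entry exceeds it; the others contribute what they
  did before, plus one for each position in \<open>{max k q<..Suc n}\<close>.
\<close>

lemma inv_q_insert_max:
  assumes \<rho>: "\<rho> permutes {1..n}" and k: "k \<in> {1..Suc n}"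
  shows "inv_q q (Suc n) (\<rho> \<circ> word_prod (rev [k..<Suc n])) = inv_q q n \<rho> + (Suc n - max k q)"
proof -
  define c where "c = word_prod (rev [k..<Suc n])"
  have "c j = (if j = k then Suc n else if k < j \<and> j \<le> Suc n then j - 1 else j)" for j
    unfolding c_def using k by (intro word_prod_descending) auto
  then have "c k = Suc n" by simp
  have bij: "bij_betw c ({1..Suc n} - {k}) {1..n}"
    using bij_betw_word_prod_descending[of k "Suc n"] k
    by (simp add: c_def atLeastLessThanSuc_atLeastAtMost)
  have "c permutes {1..Suc n}"
    unfolding c_def using k by (intro word_prod_descending_permutes) auto
  then have "\<rho> \<circ> c permutes {1..Suc n}"
    using permutes_subset[OF \<rho>, of "{1..Suc n}"] by (intro permutes_compose) auto
  then have "\<rho> (c j) \<le> Suc n" if "j \<in> {1..Suc n}" for j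
    using that permutes_in_image by fastforce
  then have "{j\<in>{1..<k}. (\<rho> \<circ> c) j > (\<rho> \<circ> c) k} = {}"
    using k \<open>c k = Suc n\<close> permutes_fixes_Suc[OF \<rho>] by (fastforce simp: not_less)
  then have "m_q q (\<rho> \<circ> c) k = 0"
    by (simp only: m_q_def) simp
  then have "inv_q q (Suc n) (\<rho> \<circ> c) = (\<Sum>i\<in>{1..Suc n} - {k}. m_q q (\<rho> \<circ> c) i)"
    unfolding inv_q_eq_sum using k by (subst sum.remove[of _ k]) auto
  also have "\<dots> = (\<Sum>i\<in>{1..Suc n} - {k}. m_q q \<rho> (c i) + of_bool (max k q < i))"
    unfolding c_def by (intro sum.cong refl m_q_insert_max[OF \<rho> k])
  also have "\<dots> = (\<Sum>i\<in>{1..Suc n} - {k}. m_q q \<rho> (c i)) +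
      (\<Sum>i\<in>{1..Suc n} - {k}. of_bool (max k q < i))"
    by (rule sum.distrib)
  also have "(\<Sum>i\<in>{1..Suc n} - {k}. m_q q \<rho> (c i)) = inv_q q n \<rho>"
    unfolding inv_q_eq_sum by (rule sum.reindex_bij_betw[OF bij])
  also have "(\<Sum>i\<in>{1..Suc n} - {k}. of_bool (max k q < i)) = Suc n - max k q"
  proof -
    have "({1..Suc n} - {k}) \<inter> {i. max k q < i} = {max k q<..Suc n}" by auto
    then show ?thesis by (simp add: sum_of_bool_eq del: max_less_iff_conj)
  qed
  finally show ?thesis unfolding c_def .
qed

section \<open>The \<open>q\<close>-length is the \<open>q\<close>-inversion number\<close>

lemma length_filter_canonical_presentation:
  assumes "1 \<le> n" "is_canonical_presentation n \<pi> ws"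
  shows "length (filter ((\<le>) q) ws) = inv_q q n \<pi>"
  using assms
proof (induction n arbitrary: \<pi> ws rule: dec_induct)
  case base
  then show ?case
    by (simp add: is_canonical_presentation_1[unfolded One_nat_def] inv_q_eq_sum m_q_def)
next
  case (step n)
  obtain k \<rho> us where k: "k \<in> {1..Suc n}" and us: "is_canonical_presentation n \<rho> us"
    and ws: "ws = us @ rev [k..<Suc n]" and \<pi>: "\<pi> = \<rho> \<circ> word_prod (rev [k..<Suc n])"
    using step.prems is_canonical_presentation_Suc[OF step.hyps(1)] by blast
  have "length (filter ((\<le>) q) ws) = length (filter ((\<le>) q) us) + (Suc n - max k q)"
    unfolding ws filter_append length_append rev_filter[symmetric] length_rev
      length_filter_ge_upt ..
  also have "\<dots> = inv_q q n \<rho> + (Suc n - max k q)"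
    by (simp only: step.IH[OF us])
  also have "\<dots> = inv_q q (Suc n) \<pi>"
    unfolding \<pi> using k is_canonical_presentation_permutes[OF step.hyps(1) us]
    by (intro inv_q_insert_max[symmetric])
  finally show ?case .
qed

theorem proposition2p1:
  fixes q n :: nat and \<sigma> :: "nat \<Rightarrow> nat"
  assumes "q \<ge> 1" and "n \<ge> 1"
    and "\<sigma> permutes {1..n}"
  shows "q_length q n \<sigma> = inv_q q n \<sigma>"
proof -
  obtain ws where ws: "is_canonical_presentation n \<sigma> ws"
    using is_canonical_presentation_exists assms(2,3) by blast
  then have "canonical_presentation n \<sigma> = ws"
    unfolding canonical_presentation_def
    using is_canonical_presentation_unique[OF assms(2)] by blast
  then show ?thesis
    unfolding q_length_def using length_filter_canonical_presentation[OF assms(2) ws] by simp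
qed

end
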